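(* Let $(X,A,m,\alpha)$ be a micro-macro system and $n\ge1$. (a) $\sigma_n^q\ge0$ for all $q\in\mathrm{Prob}(A)$ if and only if $\alpha^n$ preserves entropy, i.e. $S(\alpha^n i)=S(i)$ for all $i\in X$. (b) $\Delta_n^q\ge0$ for all $q\in\mathrm{Prob}(A)$ if and only if for every $a\in A$ the vector $\big([\alpha^n]_{ab}-[\alpha^{n-1}]_{ab}\big)_{b\in A}\in\mathbb{R}^A$ lies in the same closed half-space as $(S(b))_{b\in A}$ with respect to the hyperplane orthogonal to $(S(b))_{b\in A}$, i.e. $\sum_{b\in A}\big([\alpha^n]_{ab}-[\alpha^{n-1}]_{ab}\big)S(b)\ge0$. (c) If $\alpha$ has return time $d$, then $\sigma_d=0$ and thus $\sigma_d^q=0$ for all $q\in\mathrm{Prob}(A)$; moreover, for each $q$, either $\Delta_k^q=0$ for all $1\le k\le d$, or there exists $1\le k\le d$ with $\Delta_k^q<0$.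
   Context: A micro-macro system $(X,A,m,\alpha)$ consists of finite sets $X$, $A$, a bijection $\alpha:X\to X$ and a surjection $m:X\to A$; identify $a\in A$ with $m^{-1}(a)$, $|a|=|m^{-1}(a)|$, $S(a)=\ln|a|$, $S(i)=\ln|m(i)|$. For $k\ge0$, $[\alpha^k]_{ab}=|\{i\in a:\alpha^k(i)\in b\}|/|a|$ and $([\alpha^k]q)_b=\sum_a q_a[\alpha^k]_{ab}$. For $q\in\mathrm{Prob}(A)$, $S(q)=\sum_aq_aS(a)$ and $(cq)_i=q_{m(i)}/|m(i)|$. Define $\sigma_n(i)=\frac1n(S(\alpha^n i)-S(i))$, $\sigma_n^q=\sum_{i\in X}(cq)_i\sigma_n(i)$, and $\Delta_n^q=S([\alpha^n]q)-S([\alpha^{n-1}]q)$. The return time of $\alpha$ is the smallest $d\ge1$ with $\alpha^d=\mathrm{id}_X$. *)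

theory Defs
  imports Complex_Main
begin

definition micro_macro_system ::
  "'x set \<Rightarrow> 'a set \<Rightarrow> ('x \<Rightarrow> 'a) \<Rightarrow> ('x \<Rightarrow> 'x) \<Rightarrow> bool" where
  "micro_macro_system X A m \<alpha> \<longleftrightarrow>
     finite X \<and> finite A \<and> bij_betw \<alpha> X X \<and> m ` X = A"

(* The macrostate a, identified with its fibre in X. *)
definition macrostate :: "'x set \<Rightarrow> ('x \<Rightarrow> 'a) \<Rightarrow> 'a \<Rightarrow> 'x set" where
  "macrostate X m a = {i \<in> X. m i = a}"

(* S(a), S(i) and S(q) in the usual overloaded notation. *)
definition macro_entropy :: "'x set \<Rightarrow> ('x \<Rightarrow> 'a) \<Rightarrow> 'a \<Rightarrow> real" where
  "macro_entropy X m a = ln (real (card (macrostate X m a)))"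

definition micro_entropy :: "'x set \<Rightarrow> ('x \<Rightarrow> 'a) \<Rightarrow> 'x \<Rightarrow> real" where
  "micro_entropy X m i = macro_entropy X m (m i)"

definition prob_entropy :: "'x set \<Rightarrow> 'a set \<Rightarrow> ('x \<Rightarrow> 'a) \<Rightarrow> ('a \<Rightarrow> real) \<Rightarrow> real" where
  "prob_entropy X A m q = (\<Sum>a\<in>A. q a * macro_entropy X m a)"

(* Values outside A are irrelevant and left unconstrained. *)
definition Prob :: "'a set \<Rightarrow> ('a \<Rightarrow> real) set" where
  "Prob A = {q. (\<forall>a\<in>A. 0 \<le> q a) \<and> (\<Sum>a\<in>A. q a) = 1}"

(* The matrix entry [\<alpha>^k]_{ab}. *)
definition transition ::
  "'x set \<Rightarrow> ('x \<Rightarrow> 'a) \<Rightarrow> ('x \<Rightarrow> 'x) \<Rightarrow> nat \<Rightarrow> 'a \<Rightarrow> 'a \<Rightarrow> real" where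
  "transition X m \<alpha> k a b =
     real (card {i \<in> macrostate X m a. (\<alpha> ^^ k) i \<in> macrostate X m b})
       / real (card (macrostate X m a))"

(* The distribution [\<alpha>^k]q. *)
definition evolve ::
  "'x set \<Rightarrow> 'a set \<Rightarrow> ('x \<Rightarrow> 'a) \<Rightarrow> ('x \<Rightarrow> 'x) \<Rightarrow> nat \<Rightarrow> ('a \<Rightarrow> real) \<Rightarrow> 'a \<Rightarrow> real" where
  "evolve X A m \<alpha> k q b = (\<Sum>a\<in>A. q a * transition X m \<alpha> k a b)"

(* The distribution cq on X, uniform on each macrostate. *)
definition coarse_lift :: "'x set \<Rightarrow> ('x \<Rightarrow> 'a) \<Rightarrow> ('a \<Rightarrow> real) \<Rightarrow> 'x \<Rightarrow> real" where
  "coarse_lift X m q i = q (m i) / real (card (macrostate X m (m i)))"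

definition sigma :: "'x set \<Rightarrow> ('x \<Rightarrow> 'a) \<Rightarrow> ('x \<Rightarrow> 'x) \<Rightarrow> nat \<Rightarrow> 'x \<Rightarrow> real" where
  "sigma X m \<alpha> n i =
     1 / real n * (micro_entropy X m ((\<alpha> ^^ n) i) - micro_entropy X m i)"

definition sigma_mean ::
  "'x set \<Rightarrow> ('x \<Rightarrow> 'a) \<Rightarrow> ('x \<Rightarrow> 'x) \<Rightarrow> nat \<Rightarrow> ('a \<Rightarrow> real) \<Rightarrow> real" where
  "sigma_mean X m \<alpha> n q = (\<Sum>i\<in>X. coarse_lift X m q i * sigma X m \<alpha> n i)"

(* Only meaningful for n \<ge> 1, because of the truncated n - 1. *)
definition Delta ::
  "'x set \<Rightarrow> 'a set \<Rightarrow> ('x \<Rightarrow> 'a) \<Rightarrow> ('x \<Rightarrow> 'x) \<Rightarrow> nat \<Rightarrow> ('a \<Rightarrow> real) \<Rightarrow> real" where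
  "Delta X A m \<alpha> n q =
     prob_entropy X A m (evolve X A m \<alpha> n q)
       - prob_entropy X A m (evolve X A m \<alpha> (n - 1) q)"

definition return_time :: "'x set \<Rightarrow> ('x \<Rightarrow> 'x) \<Rightarrow> nat" where
  "return_time X \<alpha> = (LEAST d. 1 \<le> d \<and> (\<forall>i\<in>X. (\<alpha> ^^ d) i = i))"

end

theory Submission
  imports Defs
begin

text \<open>
  Parts (a) and (b) test nonnegativity on point masses. For (a), put \<open>f i = S(i)\<close> and
  \<open>g = \<alpha>^n\<close>. As \<open>g\<close> is a bijection,
  \<open>\<Sum>\<^sub>i (f(g i) - f i)\<^sup>2 = -2 \<Sum>\<^sub>i f i (f(g i) - f i)\<close>; grouping the right-hand side by macrostates,
  where \<open>f\<close> is constant and nonnegative and the increments have nonnegative sum, shows that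
  the sum of squares is at most zero. In (c) the increments \<open>\<Delta>\<^sub>1, \<dots>, \<Delta>\<^sub>d\<close> telescope to zero.
\<close>

lemma point_mass_in_Prob:
  assumes "finite A" "a \<in> A"
  shows "(\<lambda>b. of_bool (b = a)) \<in> Prob A"
  using assms by (auto simp: Prob_def of_bool_def)

text \<open>A nonempty finite fibre has at least one point, so its logarithm is nonnegative;
  cardinality 0 is covered by the convention \<open>ln 0 = 0\<close>.\<close>

lemma macro_entropy_nonneg: "0 \<le> macro_entropy X m a"
  by (cases "card (macrostate X m a) = 0") (auto simp: macro_entropy_def)

lemma bij_betw_eq_comp_if_sum_increments_nonneg:
  fixes f :: "'x \<Rightarrow> real"
  assumes fin: "finite X" and bij: "bij_betw g X X"
    and f: "\<And>i. i \<in> X \<Longrightarrow> f i = h (m i)"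
    and h: "\<And>a. a \<in> m ` X \<Longrightarrow> 0 \<le> h a"
    and incr: "\<And>a. a \<in> m ` X \<Longrightarrow> 0 \<le> (\<Sum>i | i \<in> X \<and> m i = a. f (g i) - f i)"
    and "i \<in> X"
  shows "f (g i) = f i"
proof -
  \<comment> \<open>Bijectivity of \<open>g\<close> enters only here: it permutes the values of
    \<open>f\<close>, so their sum of squares is preserved.\<close>
  have sq: "(\<Sum>i\<in>X. (f (g i))\<^sup>2) = (\<Sum>i\<in>X. (f i)\<^sup>2)"
    by (rule sum.reindex_bij_betw[OF bij])
  have "(\<Sum>i\<in>X. f i * (f (g i) - f i))
      = (\<Sum>a\<in>m ` X. \<Sum>i | i \<in> X \<and> m i = a. f i * (f (g i) - f i))"
    using fin by (simp add: sum.group)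
  also have "\<dots> = (\<Sum>a\<in>m ` X. h a * (\<Sum>i | i \<in> X \<and> m i = a. f (g i) - f i))"
    unfolding sum_distrib_left by (intro sum.cong refl) (simp add: f)
  also have "\<dots> \<ge> 0"
    by (intro sum_nonneg mult_nonneg_nonneg h incr)
  finally have nonneg: "0 \<le> (\<Sum>i\<in>X. f i * (f (g i) - f i))" .
  \<comment> \<open>The square is expanded around \<open>f i\<close>, so that the remaining cross
    term is exactly the quantity just bounded from below.\<close>
  have "(\<Sum>i\<in>X. (f (g i) - f i)\<^sup>2)
      = (\<Sum>i\<in>X. (f (g i))\<^sup>2 - (f i)\<^sup>2 - 2 * (f i * (f (g i) - f i)))"
    by (intro sum.cong refl) (simp add: power2_eq_square algebra_simps)
  also have "\<dots> = - 2 * (\<Sum>i\<in>X. f i * (f (g i) - f i))"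
    by (simp add: sum_subtractf sq flip: sum_distrib_left)
  finally have "(\<Sum>i\<in>X. (f (g i) - f i)\<^sup>2) \<le> 0"
    using nonneg by simp
  then have "(\<Sum>i\<in>X. (f (g i) - f i)\<^sup>2) = 0"
    by (intro antisym sum_nonneg) auto
  then show ?thesis
    using fin \<open>i \<in> X\<close> by (simp add: sum_nonneg_eq_0_iff)
qed

text \<open>The lift of a point mass at \<open>a\<close> is uniform on the fibre of
  \<open>a\<close>, so only that fibre contributes. If the fibre is empty, both sides are 0.\<close>

lemma sigma_mean_point_mass:
  assumes "finite X"
  shows "sigma_mean X m \<alpha> n (\<lambda>b. of_bool (b = a)) =
    (\<Sum>i | i \<in> X \<and> m i = a. micro_entropy X m ((\<alpha> ^^ n) i) - micro_entropy X m i)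
      / (real n * real (card (macrostate X m a)))"
proof -
  have "sigma_mean X m \<alpha> n (\<lambda>b. of_bool (b = a)) =
      (\<Sum>i\<in>X. if m i = a
        then sigma X m \<alpha> n i / real (card (macrostate X m a)) else 0)"
    unfolding sigma_mean_def by (intro sum.cong refl) (auto simp: coarse_lift_def)
  also have "\<dots> = (\<Sum>i | i \<in> X \<and> m i = a. sigma X m \<alpha> n i / real (card (macrostate X m a)))"
    using assms by (simp add: sum.inter_filter)
  finally show ?thesis
    by (simp add: sigma_def sum_divide_distrib)
qed

lemma sigma_mean_nonneg_iff:
  assumes sys: "micro_macro_system X A m \<alpha>" and n: "1 \<le> n"
  shows "(\<forall>q\<in>Prob A. 0 \<le> sigma_mean X m \<alpha> n q) \<longleftrightarrow>
    (\<forall>i\<in>X. micro_entropy X m ((\<alpha> ^^ n) i) = micro_entropy X m i)"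
proof
  assume nonneg: "\<forall>q\<in>Prob A. 0 \<le> sigma_mean X m \<alpha> n q"
  have fin: "finite X" "finite A" and bij: "bij_betw \<alpha> X X" and A: "m ` X = A"
    using sys by (auto simp: micro_macro_system_def)
  have "0 \<le> (\<Sum>i | i \<in> X \<and> m i = a. micro_entropy X m ((\<alpha> ^^ n) i) - micro_entropy X m i)"
    if "a \<in> m ` X" for a
  proof -
    \<comment> \<open>The fibre is nonempty because \<open>a\<close> is a value of \<open>m\<close>;
      hence the denominator is positive and the sign of the mean is that of the fibre sum.\<close>
    have "macrostate X m a \<noteq> {}" "finite (macrostate X m a)"
      using that fin by (auto simp: macrostate_def)
    then have "0 < real n * real (card (macrostate X m a))"
      using n by (simp add: card_gt_0_iff)
    moreover have "0 \<le> sigma_mean X m \<alpha> n (\<lambda>b. of_bool (b = a))"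
      using nonneg point_mass_in_Prob[OF fin(2)] that A by blast
    ultimately show ?thesis
      unfolding sigma_mean_point_mass[OF fin(1)] by (simp add: zero_le_divide_iff)
  qed
  then show "\<forall>i\<in>X. micro_entropy X m ((\<alpha> ^^ n) i) = micro_entropy X m i"
    using bij_betw_eq_comp_if_sum_increments_nonneg[OF fin(1) bij_betw_funpow[OF bij],
        where f = "micro_entropy X m" and h = "macro_entropy X m" and m = m]
    by (simp add: micro_entropy_def macro_entropy_nonneg)
next
  assume "\<forall>i\<in>X. micro_entropy X m ((\<alpha> ^^ n) i) = micro_entropy X m i"
  then show "\<forall>q\<in>Prob A. 0 \<le> sigma_mean X m \<alpha> n q"
    by (simp add: sigma_mean_def sigma_def)
qed

lemma prob_entropy_evolve:
  "prob_entropy X A m (evolve X A m \<alpha> k q) =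
    (\<Sum>a\<in>A. q a * (\<Sum>b\<in>A. transition X m \<alpha> k a b * macro_entropy X m b))"
  unfolding prob_entropy_def evolve_def sum_distrib_right sum_distrib_left
  by (subst sum.swap) (simp add: mult.assoc)

text \<open>Exchanging sums makes \<open>Delta\<close> linear in \<open>q\<close>, with the inner
  products of the half-space condition as coefficients. Its sign on the simplex is therefore decided
  at the vertices.\<close>

lemma Delta_altdef:
  "Delta X A m \<alpha> n q = (\<Sum>a\<in>A. q a * (\<Sum>b\<in>A.
    (transition X m \<alpha> n a b - transition X m \<alpha> (n - 1) a b) * macro_entropy X m b))"
  by (simp add: Delta_def prob_entropy_evolve sum_subtractf left_diff_distrib right_diff_distrib)

lemma Delta_nonneg_iff:
  assumes "finite A"
  shows "(\<forall>q\<in>Prob A. 0 \<le> Delta X A m \<alpha> n q) \<longleftrightarrow>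
    (\<forall>a\<in>A. 0 \<le> (\<Sum>b\<in>A.
      (transition X m \<alpha> n a b - transition X m \<alpha> (n - 1) a b) * macro_entropy X m b))"
    (is "_ \<longleftrightarrow> (\<forall>a\<in>A. 0 \<le> ?D a)")
proof
  assume nonneg: "\<forall>q\<in>Prob A. 0 \<le> Delta X A m \<alpha> n q"
  show "\<forall>a\<in>A. 0 \<le> ?D a"
  proof
    fix a assume "a \<in> A"
    then have "Delta X A m \<alpha> n (\<lambda>b. of_bool (b = a)) = ?D a"
      unfolding Delta_altdef using assms
      by (simp add: of_bool_def if_distrib[of "\<lambda>x. x * _"] cong: if_cong)
    then show "0 \<le> ?D a"
      using nonneg point_mass_in_Prob[OF assms \<open>a \<in> A\<close>] by metis
  qed
next
  assume D: "\<forall>a\<in>A. 0 \<le> ?D a"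
  show "\<forall>q\<in>Prob A. 0 \<le> Delta X A m \<alpha> n q"
  proof
    fix q assume "q \<in> Prob A"
    then have "0 \<le> q a * ?D a" if "a \<in> A" for a
      using D that by (simp add: Prob_def)
    then show "0 \<le> Delta X A m \<alpha> n q"
      unfolding Delta_altdef by (rule sum_nonneg)
  qed
qed

text \<open>Pigeonhole: a finite set has finitely many self-maps, so two powers of \<alpha> agree on
  it, and injectivity cancels the smaller one. This guarantees that the \<open>LEAST\<close> in
  \<open>return_time\<close> is attained.\<close>

lemma finite_bij_betw_funpow_eq_id:
  assumes fin: "finite X" and bij: "bij_betw \<alpha> X X"
  shows "\<exists>d\<ge>1. \<forall>i\<in>X. (\<alpha> ^^ d) i = i"
proof -
  \<comment> \<open>Powers of \<alpha> may differ outside \<open>X\<close>, so they are compared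
    through their graphs over \<open>X\<close>, which lie in the finite set
    \<open>Pow (X \<times> X)\<close>.\<close>
  let ?graph = "\<lambda>k. (\<lambda>i. (i, (\<alpha> ^^ k) i)) ` X"
  have "?graph k \<subseteq> X \<times> X" for k
    using bij_betw_apply[OF bij_betw_funpow[OF bij]] by auto
  then have "range ?graph \<subseteq> Pow (X \<times> X)"
    by blast
  then have "finite (range ?graph)"
    by (rule finite_subset) (simp add: fin)
  then have "\<not> inj ?graph"
    using finite_imageD infinite_UNIV_nat by blast
  then obtain j k where "j < k" and eq: "?graph j = ?graph k"
    unfolding inj_def by (metis linorder_neqE_nat)
  show ?thesis
  proof (intro exI conjI ballI)
    show "1 \<le> k - j" using \<open>j < k\<close> by simp
    fix i assume i: "i \<in> X"
    then have "(i, (\<alpha> ^^ j) i) \<in> ?graph k"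
      unfolding eq[symmetric] by blast
    then have "(\<alpha> ^^ j) i = (\<alpha> ^^ k) i"
      by auto
    also have "\<dots> = (\<alpha> ^^ j) ((\<alpha> ^^ (k - j)) i)"
      using \<open>j < k\<close> funpow_add[of j "k - j" \<alpha>] by simp
    finally show "(\<alpha> ^^ (k - j)) i = i"
      using bij_betw_imp_inj_on[OF bij_betw_funpow[OF bij, of j]]
        bij_betw_apply[OF bij_betw_funpow[OF bij] i] i
      by (metis inj_onD)
  qed
qed

lemma funpow_return_time:
  assumes "finite X" "bij_betw \<alpha> X X" "i \<in> X"
  shows "(\<alpha> ^^ return_time X \<alpha>) i = i"
  using LeastI_ex[OF finite_bij_betw_funpow_eq_id[OF assms(1,2)]] assms(3)
  unfolding return_time_def by auto

text \<open>The sum telescopes. It starts at 1, so the truncated \<open>n - 1\<close> in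
  \<open>Delta\<close> is always the true predecessor.\<close>

lemma sum_Delta:
  "(\<Sum>k=1..d. Delta X A m \<alpha> k q) =
    prob_entropy X A m (evolve X A m \<alpha> d q) - prob_entropy X A m (evolve X A m \<alpha> 0 q)"
  by (induction d) (auto simp: Delta_def)

lemma Delta_zero_or_neg:
  assumes "\<And>i. i \<in> X \<Longrightarrow> (\<alpha> ^^ d) i = i"
  shows "(\<forall>k\<in>{1..d}. Delta X A m \<alpha> k q = 0) \<or> (\<exists>k\<in>{1..d}. Delta X A m \<alpha> k q < 0)"
proof -
  have "{i \<in> macrostate X m a. (\<alpha> ^^ d) i \<in> B} = {i \<in> macrostate X m a. (\<alpha> ^^ 0) i \<in> B}" for a B
    using assms by (auto simp: macrostate_def)
  \<comment> \<open>The comparison is with time 0 and not with \<open>q\<close> itself, since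
    \<open>evolve\<close> at time 0 need not agree with \<open>q\<close> outside
    \<open>A\<close>.\<close>
  then have "evolve X A m \<alpha> d q = evolve X A m \<alpha> 0 q"
    by (simp add: fun_eq_iff evolve_def transition_def)
  then have "(\<Sum>k=1..d. Delta X A m \<alpha> k q) = 0"
    unfolding sum_Delta by simp
  \<comment> \<open>If no increment is negative, a vanishing sum of nonnegative terms forces each of
    them to vanish.\<close>
  then show ?thesis
    using sum_nonneg_eq_0_iff[of "{1..d}" "\<lambda>k. Delta X A m \<alpha> k q"]
    by (meson finite_atLeastAtMost not_less)
qed

theorem theorem23:
  fixes X :: "'x set" and A :: "'a set"
    and m :: "'x \<Rightarrow> 'a" and \<alpha> :: "'x \<Rightarrow> 'x" and n :: nat
  assumes "micro_macro_system X A m \<alpha>"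
    and "1 \<le> n"
  shows
    "((\<forall>q\<in>Prob A. 0 \<le> sigma_mean X m \<alpha> n q) \<longleftrightarrow>
        (\<forall>i\<in>X. micro_entropy X m ((\<alpha> ^^ n) i) = micro_entropy X m i))
     \<and>
     ((\<forall>q\<in>Prob A. 0 \<le> Delta X A m \<alpha> n q) \<longleftrightarrow>
        (\<forall>a\<in>A. 0 \<le> (\<Sum>b\<in>A.
            (transition X m \<alpha> n a b - transition X m \<alpha> (n - 1) a b) * macro_entropy X m b)))
     \<and>
     (\<forall>d. return_time X \<alpha> = d \<longrightarrow>
        (\<forall>i\<in>X. sigma X m \<alpha> d i = 0) \<and>
        (\<forall>q\<in>Prob A. sigma_mean X m \<alpha> d q = 0) \<and>
        (\<forall>q\<in>Prob A.
           (\<forall>k\<in>{1..d}. Delta X A m \<alpha> k q = 0) \<or>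
           (\<exists>k\<in>{1..d}. Delta X A m \<alpha> k q < 0)))"
proof (intro conjI allI impI)
  have fin: "finite X" "finite A" and bij: "bij_betw \<alpha> X X"
    using assms(1) by (auto simp: micro_macro_system_def)
  show "(\<forall>q\<in>Prob A. 0 \<le> sigma_mean X m \<alpha> n q) \<longleftrightarrow>
      (\<forall>i\<in>X. micro_entropy X m ((\<alpha> ^^ n) i) = micro_entropy X m i)"
    by (rule sigma_mean_nonneg_iff[OF assms])
  show "(\<forall>q\<in>Prob A. 0 \<le> Delta X A m \<alpha> n q) \<longleftrightarrow>
      (\<forall>a\<in>A. 0 \<le> (\<Sum>b\<in>A.
        (transition X m \<alpha> n a b - transition X m \<alpha> (n - 1) a b) * macro_entropy X m b))"
    by (rule Delta_nonneg_iff[OF fin(2)])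
  fix d assume "return_time X \<alpha> = d"
  then have d: "(\<alpha> ^^ d) i = i" if "i \<in> X" for i
    using funpow_return_time[OF fin(1) bij] that by simp
  then show "\<forall>i\<in>X. sigma X m \<alpha> d i = 0"
    by (simp add: sigma_def)
  then show "\<forall>q\<in>Prob A. sigma_mean X m \<alpha> d q = 0"
    by (simp add: sigma_mean_def)
  show "\<forall>q\<in>Prob A. (\<forall>k\<in>{1..d}. Delta X A m \<alpha> k q = 0) \<or>
      (\<exists>k\<in>{1..d}. Delta X A m \<alpha> k q < 0)"
    using Delta_zero_or_neg d by blast
qed

end
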